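(* Let $G$ be a finite group of order $n>1$, and let $\delta$ be the smallest dimension of a nontrivial representation of $G$. Let $A$, $B$, $C$ be subsets of $G$ with $|A|=rn$, $|B|=sn$, $|C|=tn$. Let $p$ be a real number such that there are exactly $p\,r\,s\,t\,n^2$ solutions of the equation $ab=c$ with $a\in A$, $b\in B$, $c\in C$. Then $$ r\,s\,t\,(1-p)^2\,\delta \leq 1. $$
   Context: Representations are finite-dimensional complex linear representations; a representation is nontrivial if some group element does not act as the identity. The number of solutions of $ab=c$ is the number of triples $(a,b,c)\in A\times B\times C$ with $ab=c$. *)

theory Defs
  imports
    Complex_Main
    "HOL-Algebra.Coset"
    "Jordan_Normal_Form.Matrix"
begin

definition GL :: "nat \<Rightarrow> complex mat monoid" where
  "GL d = units_of (ring_mat TYPE(complex) d ())"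

text \<open>Every \<open>d\<close>-dimensional complex vector space is isomorphic to \<open>d\<close>-dimensional coordinate space,
  so representations are taken in matrix form.\<close>

definition representation :: "('a, 'b) monoid_scheme \<Rightarrow> nat \<Rightarrow> ('a \<Rightarrow> complex mat) \<Rightarrow> bool" where
  "representation G d \<rho> \<longleftrightarrow> \<rho> \<in> hom G (GL d)"

definition nontrivial_representation ::
    "('a, 'b) monoid_scheme \<Rightarrow> nat \<Rightarrow> ('a \<Rightarrow> complex mat) \<Rightarrow> bool" where
  "nontrivial_representation G d \<rho> \<longleftrightarrow>
     representation G d \<rho> \<and> (\<exists>g\<in>carrier G. \<rho> g \<noteq> 1\<^sub>m d)"

text \<open>The \<open>LEAST\<close> is unspecified if no nontrivial representation exists. For a finite group of order
  greater than 1 the regular representation is one.\<close>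

definition min_nontrivial_dim :: "('a, 'b) monoid_scheme \<Rightarrow> nat" where
  "min_nontrivial_dim G = (LEAST d. \<exists>\<rho>. nontrivial_representation G d \<rho>)"

end

theory Submission
  imports Defs "HOL-Analysis.Function_Topology" "HOL-Analysis.Convex"
begin

text \<open>The number of solutions of \<open>ab = c\<close> is \<open>\<Sum>x\<in>C. (T 1\<^sub>B) x\<close>, where \<open>T\<close> is the operator on
  functions \<open>G \<rightarrow> \<real>\<close> with the 0/1 kernel \<open>K x y = 1\<close> iff \<open>x y\<inverse> \<in> A\<close>. The constant part \<open>s\<close> of the
  indicator \<open>1\<^sub>B\<close> contributes exactly the expected count \<open>r s t n\<^sup>2\<close>, so the deviation from it is
  governed by \<open>T\<close> on the functions of sum zero. If \<open>\<lambda>\<close> is the maximum of \<open>\<parallel>T f\<parallel>\<^sup>2\<close> over unit vectors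
  \<open>f\<close> of sum zero, Cauchy-Schwarz bounds the deviation by
  \<open>(r s t (1 - p) n\<^sup>2)\<^sup>2 \<le> t n \<cdot> \<lambda> \<cdot> s n\<close>.

  It remains to see that \<open>\<delta> \<lambda> \<le> r n\<^sup>2\<close>, which is where the absence of small representations enters.
  Right translation commutes with \<open>T\<close> and preserves norms and sums. Hence the set \<open>E\<close> of
  sum-zero functions with \<open>\<parallel>T f\<parallel>\<^sup>2 = \<lambda> \<parallel>f\<parallel>\<^sup>2\<close> is translation-invariant, and since
  \<open>\<lambda> \<parallel>f\<parallel>\<^sup>2 - \<parallel>T f\<parallel>\<^sup>2\<close> is a nonnegative quadratic form, its zero set \<open>E\<close> is a linear space. So \<open>G\<close> is
  represented on \<open>E\<close>, and nontrivially: a function fixed by all translations is constant, and a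
  constant of sum zero vanishes. Therefore \<open>\<delta> \<le> dim E\<close> (\<open>min_nontrivial_dim_le\<close>). On the other hand,
  each member of an orthonormal basis of \<open>E\<close> contributes \<open>\<lambda>\<close> to the squared Hilbert-Schmidt norm of
  \<open>T\<close>, which is \<open>n |A| = r n\<^sup>2\<close>; Bessel's inequality applied to the rows of the kernel therefore gives
  \<open>dim E \<cdot> \<lambda> \<le> r n\<^sup>2\<close> (\<open>orthonormal_maximisers_le\<close>). The two estimates are combined in
  \<open>quasirandom_energy_bound\<close>.

  Working with the maximum of a quadratic form replaces the spectral theorem for \<open>T\<^sup>*T\<close> by
  compactness of the unit sphere, and keeps everything real until the representing matrices are
  regarded as complex ones.\<close>

section \<open>Orthonormal families of functions on a finite set\<close>

text \<open>Functions are total on the ambient type but only their values on \<open>X\<close> matter, so this form is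
  definite only up to values outside \<open>X\<close>.\<close>

definition ip :: "'a set \<Rightarrow> ('a \<Rightarrow> real) \<Rightarrow> ('a \<Rightarrow> real) \<Rightarrow> real" where
  "ip X f g = (\<Sum>x\<in>X. f x * g x)"

lemma ip_commute: "ip X f g = ip X g f"
  by (simp add: ip_def mult.commute)

lemma ip_add_right: "ip X h (\<lambda>x. f x + c * g x) = ip X h f + c * ip X h g"
  by (simp add: ip_def algebra_simps sum.distrib sum_distrib_left)

lemma ip_sum_right: "ip X h (\<lambda>x. \<Sum>i\<in>I. c i * e i x) = (\<Sum>i\<in>I. c i * ip X h (e i))"
  unfolding ip_def sum_distrib_left
  by (subst sum.swap) (simp add: algebra_simps)

lemma ip_diff_right: "ip X h (\<lambda>x. f x - g x) = ip X h f - ip X h g"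
  by (simp add: ip_def algebra_simps sum_subtractf)

lemma ip_cong_right: "(\<And>x. x \<in> X \<Longrightarrow> f x = g x) \<Longrightarrow> ip X h f = ip X h g"
  unfolding ip_def by (rule sum.cong) auto

lemma ip_self_nonneg: "0 \<le> ip X f f"
  by (simp add: ip_def sum_nonneg)

lemma ip_self_eq_0_iff: "finite X \<Longrightarrow> ip X f f = 0 \<longleftrightarrow> (\<forall>x\<in>X. f x = 0)"
  by (simp add: ip_def sum_nonneg_eq_0_iff)

definition orthonormal :: "'a set \<Rightarrow> nat \<Rightarrow> (nat \<Rightarrow> 'a \<Rightarrow> real) \<Rightarrow> bool" where
  "orthonormal X d e \<longleftrightarrow> (\<forall>i<d. \<forall>j<d. ip X (e i) (e j) = (if i = j then 1 else 0))"

definition residual ::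
    "'a set \<Rightarrow> nat \<Rightarrow> (nat \<Rightarrow> 'a \<Rightarrow> real) \<Rightarrow> ('a \<Rightarrow> real) \<Rightarrow> 'a \<Rightarrow> real" where
  "residual X d e f = (\<lambda>x. f x - (\<Sum>i<d. ip X f (e i) * e i x))"

lemma residual_orthogonal:
  assumes "orthonormal X d e" "j < d"
  shows "ip X (e j) (residual X d e f) = 0"
proof -
  have "ip X (e j) (residual X d e f)
      = ip X (e j) f - (\<Sum>i<d. ip X f (e i) * (if i = j then 1 else 0))"
    using assms unfolding residual_def ip_diff_right ip_sum_right
    by (auto simp: orthonormal_def intro!: sum.cong)
  also have "\<dots> = 0"
    using assms(2) by (simp add: ip_commute if_distrib cong: if_cong)
  finally show ?thesis .
qed

lemma ip_residual:
  assumes "orthonormal X d e"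
  shows "ip X (residual X d e f) (residual X d e f) = ip X f f - (\<Sum>i<d. (ip X f (e i))\<^sup>2)"
proof -
  let ?h = "residual X d e f"
  have "ip X ?h ?h = ip X ?h f - (\<Sum>i<d. ip X f (e i) * ip X ?h (e i))"
    by (subst (2) residual_def) (simp add: ip_diff_right ip_sum_right)
  also have "\<dots> = ip X f ?h"
    using residual_orthogonal[OF assms] by (simp add: ip_commute)
  also have "\<dots> = ip X f f - (\<Sum>i<d. (ip X f (e i))\<^sup>2)"
    by (simp add: residual_def ip_diff_right ip_sum_right power2_eq_square)
  finally show ?thesis .
qed

lemma Bessel_inequality:
  assumes "orthonormal X d e"
  shows "(\<Sum>i<d. (ip X f (e i))\<^sup>2) \<le> ip X f f"
  using ip_residual[OF assms, of f] ip_self_nonneg[of X "residual X d e f"] by simp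

text \<open>The squared values of the \<open>e i\<close> at one point \<open>y\<close> are the squared coefficients of the indicator
  of \<open>y\<close>, so by Bessel they add up to at most 1; summing over \<open>y\<close> counts the family.\<close>

lemma orthonormal_length_le_card:
  assumes "finite X" "orthonormal X d e"
  shows "d \<le> card X"
proof -
  have point: "ip X (\<lambda>x. if x = y then 1 else 0) g = g y" if "y \<in> X" for y g
    using assms(1) that by (simp add: ip_def if_distrib[of "\<lambda>z. z * _"] cong: if_cong)
  have "real d = (\<Sum>i<d. ip X (e i) (e i))"
    using assms(2) by (simp add: orthonormal_def)
  also have "\<dots> = (\<Sum>y\<in>X. \<Sum>i<d. (e i y)\<^sup>2)"
    unfolding ip_def by (subst sum.swap) (simp add: power2_eq_square)
  also have "\<dots> \<le> (\<Sum>y\<in>X. 1)"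
  proof (rule sum_mono)
    fix y assume y: "y \<in> X"
    show "(\<Sum>i<d. (e i y)\<^sup>2) \<le> 1"
      using Bessel_inequality[OF assms(2), of "\<lambda>x. if x = y then 1 else 0"]
      by (simp add: point[OF y])
  qed
  finally show ?thesis by simp
qed

definition linear_space :: "('a \<Rightarrow> real) set \<Rightarrow> bool" where
  "linear_space V \<longleftrightarrow> (\<lambda>x. 0) \<in> V \<and> (\<forall>f\<in>V. \<forall>g\<in>V. \<forall>c. (\<lambda>x. f x + c * g x) \<in> V)"

lemma linear_space_combination:
  "linear_space V \<Longrightarrow> f \<in> V \<Longrightarrow> g \<in> V \<Longrightarrow> (\<lambda>x. f x + c * g x) \<in> V"
  by (simp add: linear_space_def)

lemma linear_space_sum:
  fixes d :: nat
  assumes "linear_space V" "\<forall>i<d. e i \<in> V"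
  shows "(\<lambda>x. \<Sum>i<d. c i * e i x) \<in> V"
  using assms(2)
proof (induction d)
  case 0
  then show ?case using assms(1) by (simp add: linear_space_def)
next
  case (Suc d)
  then show ?case using assms(1) unfolding linear_space_def by simp
qed

lemma residual_in_linear_space:
  assumes "linear_space V" "\<forall>i<d. e i \<in> V" "f \<in> V"
  shows "residual X d e f \<in> V"
proof -
  have "(\<lambda>x. f x + (-1) * (\<Sum>i<d. ip X f (e i) * e i x)) \<in> V"
    by (intro linear_space_combination linear_space_sum assms)
  then show ?thesis by (simp add: residual_def)
qed

text \<open>An orthonormal family of maximal length spans: a nonzero residual could be normalised and
  appended.\<close>

lemma orthonormal_basis_exists:
  assumes "finite X" "linear_space V"
  obtains d e where "orthonormal X d e" "\<forall>i<d. e i \<in> V"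
    "\<forall>f\<in>V. \<forall>x\<in>X. f x = (\<Sum>i<d. ip X f (e i) * e i x)"
proof -
  \<comment> \<open>The possible lengths are bounded, so one of them is the largest.\<close>
  define P where "P d \<longleftrightarrow> (\<exists>e. orthonormal X d e \<and> (\<forall>i<d. e i \<in> V))" for d
  have "P 0" by (simp add: P_def orthonormal_def)
  moreover have bound: "d \<le> card X" if "P d" for d
    using that orthonormal_length_le_card[OF assms(1)] by (auto simp: P_def)
  ultimately obtain d where d: "P d" and d_max: "\<And>d'. P d' \<Longrightarrow> d' \<le> d"
    using GreatestI_nat[of P 0] Greatest_le_nat[of P] by metis
  from d obtain e where e: "orthonormal X d e" "\<forall>i<d. e i \<in> V" by (auto simp: P_def)
  have "f x = (\<Sum>i<d. ip X f (e i) * e i x)" if f: "f \<in> V" and x: "x \<in> X" for f x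
  proof (rule ccontr)
    assume neq: "f x \<noteq> (\<Sum>i<d. ip X f (e i) * e i x)"
    define h where "h = residual X d e f"
    have "h x \<noteq> 0" using neq by (simp add: h_def residual_def)
    then have "ip X h h \<noteq> 0" using ip_self_eq_0_iff[OF assms(1)] x by blast
    then have pos: "ip X h h > 0" using ip_self_nonneg[of X h] by simp
    define c where "c = 1 / sqrt (ip X h h)"
    define u where "u = (\<lambda>x. 0 + c * h x)"
    have "h \<in> V" unfolding h_def by (rule residual_in_linear_space[OF assms(2) e(2) f])
    moreover have "(\<lambda>x. 0) \<in> V" using assms(2) by (simp add: linear_space_def)
    ultimately have "u \<in> V"
      unfolding u_def by (intro linear_space_combination assms(2))
    have ip_u: "ip X g u = c * ip X g h" for g
      by (simp add: u_def ip_def sum_distrib_left algebra_simps)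
    have "ip X u u = c * (c * ip X h h)" by (metis ip_u ip_commute)
    also have "\<dots> = 1" using pos by (simp add: c_def field_simps)
    finally have uu: "ip X u u = 1" .
    have eu: "ip X (e j) u = 0" if "j < d" for j
      using residual_orthogonal[OF e(1) that, of f] by (simp add: ip_u h_def)
    have "orthonormal X (Suc d) (e(d := u))"
      using e(1) uu eu unfolding orthonormal_def by (auto simp: less_Suc_eq ip_commute)
    moreover have "\<forall>i<Suc d. (e(d := u)) i \<in> V"
      using e(2) \<open>u \<in> V\<close> by (auto simp: less_Suc_eq)
    ultimately have "P (Suc d)" unfolding P_def by blast
    then show False using d_max by fastforce
  qed
  with e that show thesis by blast
qed

section \<open>Maximising a kernel operator on functions of sum zero\<close>

definition zero_sum :: "'a set \<Rightarrow> ('a \<Rightarrow> real) set" where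
  "zero_sum X = {f. (\<Sum>x\<in>X. f x) = 0}"

text \<open>The squared norm of the image of \<open>f\<close> under the operator with kernel \<open>K\<close>, whose value at \<open>x\<close> is the
  inner product of \<open>f\<close> with the row \<open>K x\<close>.\<close>

definition energy :: "'a set \<Rightarrow> ('a \<Rightarrow> 'a \<Rightarrow> real) \<Rightarrow> ('a \<Rightarrow> real) \<Rightarrow> real" where
  "energy X K f = (\<Sum>x\<in>X. (ip X (K x) f)\<^sup>2)"

lemma zero_sum_combination:
  "f \<in> zero_sum X \<Longrightarrow> g \<in> zero_sum X \<Longrightarrow> (\<lambda>x. f x + c * g x) \<in> zero_sum X"
  by (simp add: zero_sum_def sum.distrib flip: sum_distrib_left)

lemma energy_parallelogram:
  "energy X K (\<lambda>x. f x + c * g x) + energy X K (\<lambda>x. f x + (- c) * g x)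
    = 2 * energy X K f + 2 * c\<^sup>2 * energy X K g"
  unfolding energy_def ip_add_right
  by (simp add: sum_distrib_left power2_eq_square algebra_simps flip: sum.distrib)

lemma ip_parallelogram:
  "ip X (\<lambda>x. f x + c * g x) (\<lambda>x. f x + c * g x)
      + ip X (\<lambda>x. f x + (- c) * g x) (\<lambda>x. f x + (- c) * g x)
    = 2 * ip X f f + 2 * c\<^sup>2 * ip X g g"
  unfolding ip_def
  by (simp add: sum_distrib_left power2_eq_square algebra_simps flip: sum.distrib)

text \<open>Compactness in the product topology requires fixing the values off \<open>X\<close>; the sphere is then a
  closed subset of a product of compact intervals.\<close>

lemma compact_zero_sum_sphere:
  assumes "finite X"
  shows "compact {f \<in> zero_sum X. ip X f f = 1 \<and> (\<forall>x. x \<notin> X \<longrightarrow> f x = 0)}"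
    (is "compact ?S")
proof -
  define box :: "('a \<Rightarrow> real) set"
    where "box = PiE UNIV (\<lambda>x. if x \<in> X then {-1..1} else {0})"
  have "compact box"
    unfolding box_def compactin_euclidean_iff[symmetric] euclidean_product_topology[symmetric]
    by (subst compactin_PiE) auto
  moreover have "closed {f :: 'a \<Rightarrow> real. (\<Sum>x\<in>X. f x) = 0 \<and> ip X f f = 1}"
    unfolding ip_def
    by (intro closed_Collect_conj closed_Collect_eq continuous_intros
        continuous_on_product_coordinates)
  ultimately have "compact (box \<inter> {f. (\<Sum>x\<in>X. f x) = 0 \<and> ip X f f = 1})"
    by (rule compact_Int_closed)
  also have "box \<inter> {f. (\<Sum>x\<in>X. f x) = 0 \<and> ip X f f = 1} = ?S"
  proof -
    have "\<bar>f x\<bar> \<le> 1" if "ip X f f = 1" "x \<in> X" for f x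
    proof -
      have "(f x)\<^sup>2 \<le> (\<Sum>x\<in>X. (f x)\<^sup>2)"
        by (rule member_le_sum) (use assms that in auto)
      then show ?thesis using that(1) by (simp add: ip_def power2_eq_square abs_square_le_1[symmetric])
    qed
    then show ?thesis by (fastforce simp: box_def zero_sum_def PiE_iff abs_le_iff split: if_splits)
  qed
  finally show ?thesis .
qed

text \<open>Both sides of the inequality scale quadratically, so it suffices to maximise the energy over
  unit vectors.\<close>

lemma energy_maximum_exists:
  assumes X: "finite X" and f: "f \<in> zero_sum X" "ip X f f \<noteq> 0"
  obtains f0 where "f0 \<in> zero_sum X" "ip X f0 f0 = 1"
    "\<forall>g\<in>zero_sum X. energy X K g \<le> energy X K f0 * ip X g g"
proof -
  define S where "S = {f \<in> zero_sum X. ip X f f = 1 \<and> (\<forall>x. x \<notin> X \<longrightarrow> f x = 0)}"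
  define unit where "unit g = (\<lambda>x. if x \<in> X then g x / sqrt (ip X g g) else 0)" for g
  have ip_unit: "ip X h (unit g) = ip X h g / sqrt (ip X g g)" for h g
    by (simp add: ip_def unit_def sum_divide_distrib)
  have unit_in: "unit g \<in> S" if "g \<in> zero_sum X" "ip X g g \<noteq> 0" for g
  proof -
    have "ip X (unit g) (unit g) = 1"
      using that(2) ip_self_nonneg[of X g] by (simp add: ip_unit ip_commute[of X "unit g"])
    moreover have "(\<Sum>x\<in>X. unit g x) = (\<Sum>x\<in>X. g x) / sqrt (ip X g g)"
      by (simp add: unit_def sum_divide_distrib)
    ultimately show ?thesis using that(1) by (simp add: S_def zero_sum_def) (simp add: unit_def)
  qed
  have "continuous_on S (energy X K)"
    unfolding energy_def ip_def
    by (intro continuous_intros continuous_on_subset[OF continuous_on_product_coordinates subset_UNIV])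
  moreover have "compact S" unfolding S_def by (rule compact_zero_sum_sphere[OF X])
  moreover have "S \<noteq> {}" using unit_in f by blast
  ultimately obtain f0 where f0: "f0 \<in> S" "\<And>g. g \<in> S \<Longrightarrow> energy X K g \<le> energy X K f0"
    using continuous_attains_sup by metis
  have "energy X K g \<le> energy X K f0 * ip X g g" if g: "g \<in> zero_sum X" for g
  proof (cases "ip X g g = 0")
    case True
    then have "energy X K g = 0"
      using ip_self_eq_0_iff[OF X, of g] by (simp add: energy_def ip_def)
    then show ?thesis using True by simp
  next
    case False
    then have pos: "ip X g g > 0" using ip_self_nonneg[of X g] by simp
    have "energy X K (unit g) = energy X K g / ip X g g"
      using pos by (simp add: energy_def ip_unit power_divide sum_divide_distrib)
    with f0(2)[OF unit_in[OF g False]] pos show ?thesis by (simp add: field_simps)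
  qed
  with f0(1) that show thesis by (auto simp: S_def)
qed

text \<open>By the parallelogram law the deficits \<open>lam * ip X h h - energy X K h\<close> at \<open>h = f + c g\<close> and at
  \<open>h = f - c g\<close> add up to a combination of the deficits of \<open>f\<close> and \<open>g\<close>, which is zero. Neither is
  negative, so both vanish.\<close>

lemma linear_space_maximisers:
  assumes max: "\<And>g. g \<in> zero_sum X \<Longrightarrow> energy X K g \<le> lam * ip X g g"
  shows "linear_space {f \<in> zero_sum X. energy X K f = lam * ip X f f}" (is "linear_space ?E")
  unfolding linear_space_def
proof (intro conjI ballI allI)
  show "(\<lambda>x. 0) \<in> ?E" by (simp add: zero_sum_def energy_def ip_def)
next
  fix f g c assume f: "f \<in> ?E" and g: "g \<in> ?E"
  have z: "(\<lambda>x. f x + b * g x) \<in> zero_sum X" for b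
    using f g zero_sum_combination by blast
  have "energy X K (\<lambda>x. f x + c * g x) + energy X K (\<lambda>x. f x + (- c) * g x)
      = lam * (ip X (\<lambda>x. f x + c * g x) (\<lambda>x. f x + c * g x)
          + ip X (\<lambda>x. f x + (- c) * g x) (\<lambda>x. f x + (- c) * g x))"
    using f g unfolding energy_parallelogram ip_parallelogram by (simp add: algebra_simps)
  then have "energy X K (\<lambda>x. f x + c * g x) = lam * ip X (\<lambda>x. f x + c * g x) (\<lambda>x. f x + c * g x)"
    using max[OF z[of c]] max[OF z[of "- c"]] by (simp add: algebra_simps)
  with z[of c] show "(\<lambda>x. f x + c * g x) \<in> ?E" by simp
qed

text \<open>The right-hand side is the squared Hilbert-Schmidt norm of the operator. Bessel's inequality for
  each row bounds by it the sum of the energies of any orthonormal family.\<close>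

lemma orthonormal_maximisers_le:
  assumes "orthonormal X d e" "\<And>i. i < d \<Longrightarrow> energy X K (e i) = lam"
  shows "real d * lam \<le> (\<Sum>x\<in>X. ip X (K x) (K x))"
proof -
  have "real d * lam = (\<Sum>i<d. energy X K (e i))" using assms(2) by simp
  also have "\<dots> = (\<Sum>x\<in>X. \<Sum>i<d. (ip X (K x) (e i))\<^sup>2)"
    unfolding energy_def by (rule sum.swap)
  also have "\<dots> \<le> (\<Sum>x\<in>X. ip X (K x) (K x))"
    by (intro sum_mono Bessel_inequality[OF assms(1)])
  finally show ?thesis .
qed

section \<open>Translation-invariant spaces and representations\<close>

context group
begin

lemma sum_right_translate:
  assumes "g \<in> carrier G"
  shows "(\<Sum>x\<in>carrier G. F (x \<otimes> g)) = (\<Sum>x\<in>carrier G. F x)"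
  by (rule sum.reindex_bij_witness[where i = "\<lambda>x. x \<otimes> inv g" and j = "\<lambda>x. x \<otimes> g"])
    (use assms in \<open>auto simp: m_assoc\<close>)

lemma ip_right_translate:
  assumes "g \<in> carrier G"
  shows "ip (carrier G) (\<lambda>x. f (x \<otimes> g)) (\<lambda>x. h (x \<otimes> g)) = ip (carrier G) f h"
  unfolding ip_def using sum_right_translate[OF assms, of "\<lambda>x. f x * h x"] .

lemma zero_sum_right_translate:
  assumes "g \<in> carrier G" "f \<in> zero_sum (carrier G)"
  shows "(\<lambda>x. f (x \<otimes> g)) \<in> zero_sum (carrier G)"
  using assms sum_right_translate[OF assms(1), of f] by (simp add: zero_sum_def)

text \<open>Translating the argument of the operator translates its value: by invariance of the kernel, row
  \<open>x\<close> meets the translate of \<open>f\<close> as row \<open>x \<otimes> g\<close> meets \<open>f\<close>.\<close>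

lemma energy_right_translate:
  assumes g: "g \<in> carrier G"
    and K: "\<And>x y. x \<in> carrier G \<Longrightarrow> y \<in> carrier G \<Longrightarrow> K (x \<otimes> g) (y \<otimes> g) = K x y"
  shows "energy (carrier G) K (\<lambda>x. f (x \<otimes> g)) = energy (carrier G) K f"
proof -
  have "ip (carrier G) (K x) (\<lambda>y. f (y \<otimes> g)) = ip (carrier G) (K (x \<otimes> g)) f"
    if "x \<in> carrier G" for x
  proof -
    have "ip (carrier G) (K x) (\<lambda>y. f (y \<otimes> g))
        = ip (carrier G) (\<lambda>y. K (x \<otimes> g) (y \<otimes> g)) (\<lambda>y. f (y \<otimes> g))"
      unfolding ip_def by (rule sum.cong) (use that K in auto)
    then show ?thesis by (simp add: ip_right_translate[OF g])
  qed
  then show ?thesis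
    unfolding energy_def
    using sum_right_translate[OF g, of "\<lambda>x. (ip (carrier G) (K x) f)\<^sup>2"] by simp
qed

text \<open>The matrix of \<open>f \<mapsto> (\<lambda>x. f (x \<otimes> g))\<close> in the basis \<open>e\<close>. Right translation by \<open>g\<close> on the argument
  is a left action on functions, so on an invariant span the matrices multiply in the order of the
  group elements.\<close>

definition translation_matrix :: "nat \<Rightarrow> (nat \<Rightarrow> 'a \<Rightarrow> real) \<Rightarrow> 'a \<Rightarrow> complex mat" where
  "translation_matrix d e g =
     mat d d (\<lambda>(i, j). complex_of_real (ip (carrier G) (e i) (\<lambda>x. e j (x \<otimes> g))))"

lemma translation_matrix_one:
  assumes "orthonormal (carrier G) d e"
  shows "translation_matrix d e \<one> = 1\<^sub>m d"
proof -
  have "ip (carrier G) (e i) (\<lambda>x. e j (x \<otimes> \<one>)) = ip (carrier G) (e i) (e j)" for i j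
    by (rule ip_cong_right) simp
  then show ?thesis
    using assms unfolding translation_matrix_def orthonormal_def by (intro eq_matI) auto
qed

text \<open>The premise \<open>basis\<close> says that the span of \<open>e\<close> is invariant under translation. It allows the
  translate by \<open>h\<close> to be expanded in the basis before translating by \<open>g\<close>.\<close>

lemma translation_matrix_mult:
  assumes basis: "\<And>h j x. h \<in> carrier G \<Longrightarrow> j < d \<Longrightarrow> x \<in> carrier G \<Longrightarrow>
      e j (x \<otimes> h) = (\<Sum>k<d. ip (carrier G) (e k) (\<lambda>y. e j (y \<otimes> h)) * e k x)"
    and g: "g \<in> carrier G" and h: "h \<in> carrier G"
  shows "translation_matrix d e (g \<otimes> h) = translation_matrix d e g * translation_matrix d e h"
proof (rule eq_matI)
  let ?ip = "ip (carrier G)"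
  let ?c = "\<lambda>g i j. ?ip (e i) (\<lambda>x. e j (x \<otimes> g))"
  fix i j assume "i < dim_row (translation_matrix d e g * translation_matrix d e h)"
    and "j < dim_col (translation_matrix d e g * translation_matrix d e h)"
  then have ij: "i < d" "j < d" by (simp_all add: translation_matrix_def)
  have "?c (g \<otimes> h) i j = ?ip (e i) (\<lambda>x. \<Sum>k<d. ?c h k j * e k (x \<otimes> g))"
  proof (rule ip_cong_right)
    fix x assume x: "x \<in> carrier G"
    show "e j (x \<otimes> (g \<otimes> h)) = (\<Sum>k<d. ?c h k j * e k (x \<otimes> g))"
      using basis[OF h ij(2), of "x \<otimes> g"] x g h by (simp add: m_assoc)
  qed
  also have "\<dots> = (\<Sum>k<d. ?c h k j * ?c g i k)"
    by (rule ip_sum_right)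
  finally show "translation_matrix d e (g \<otimes> h) $$ (i, j)
      = (translation_matrix d e g * translation_matrix d e h) $$ (i, j)"
    using ij by (simp add: translation_matrix_def scalar_prod_def lessThan_atLeast0 mult.commute)
qed (simp_all add: translation_matrix_def)

lemma representation_translation_matrix:
  assumes on: "orthonormal (carrier G) d e"
    and basis: "\<And>h j x. h \<in> carrier G \<Longrightarrow> j < d \<Longrightarrow> x \<in> carrier G \<Longrightarrow>
      e j (x \<otimes> h) = (\<Sum>k<d. ip (carrier G) (e k) (\<lambda>y. e j (y \<otimes> h)) * e k x)"
  shows "representation G d (translation_matrix d e)"
proof -
  let ?\<rho> = "translation_matrix d e"
  have mult: "?\<rho> (g \<otimes> h) = ?\<rho> g * ?\<rho> h" if "g \<in> carrier G" "h \<in> carrier G" for g h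
    by (rule translation_matrix_mult) (use basis that in auto)
  have dim: "?\<rho> g \<in> carrier_mat d d" for g by (simp add: translation_matrix_def)
  have "?\<rho> g \<in> Units (ring_mat TYPE(complex) d ())" if g: "g \<in> carrier G" for g
  proof -
    have "?\<rho> (inv g) * ?\<rho> g = 1\<^sub>m d" "?\<rho> g * ?\<rho> (inv g) = 1\<^sub>m d"
      using g by (simp_all add: translation_matrix_one[OF on] flip: mult)
    then show ?thesis using dim unfolding Units_def by (auto simp: ring_mat_simps)
  qed
  then show ?thesis
    by (auto simp: representation_def GL_def hom_def units_of_def ring_mat_simps mult)
qed

text \<open>If every translation matrix were the identity, the basis vector \<open>e 0\<close> would be constant on the
  group, hence zero because its sum is zero, contradicting that it has norm 1.\<close>

lemma min_nontrivial_dim_le: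
  assumes fin: "finite (carrier G)" and on: "orthonormal (carrier G) d e"
    and zero: "\<And>i. i < d \<Longrightarrow> e i \<in> zero_sum (carrier G)" and "d \<noteq> 0"
    and basis: "\<And>h j x. h \<in> carrier G \<Longrightarrow> j < d \<Longrightarrow> x \<in> carrier G \<Longrightarrow>
      e j (x \<otimes> h) = (\<Sum>k<d. ip (carrier G) (e k) (\<lambda>y. e j (y \<otimes> h)) * e k x)"
  shows "min_nontrivial_dim G \<le> d"
proof -
  have "\<exists>g\<in>carrier G. translation_matrix d e g \<noteq> 1\<^sub>m d"
  proof (rule ccontr)
    assume "\<not> ?thesis"
    then have triv: "translation_matrix d e g $$ (k, 0) = (1\<^sub>m d :: complex mat) $$ (k, 0)"
      if "g \<in> carrier G" for g k using that by simp
    have const: "e 0 g = e 0 \<one>" if g: "g \<in> carrier G" for g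
    proof -
      have "ip (carrier G) (e k) (\<lambda>y. e 0 (y \<otimes> g)) = (if k = 0 then 1 else 0)" if "k < d" for k
        using triv[OF g, of k] that \<open>d \<noteq> 0\<close>
        by (auto simp: translation_matrix_def split: if_splits)
      then have "e 0 (\<one> \<otimes> g) = (\<Sum>k<d. (if k = 0 then 1 else 0) * e k \<one>)"
        using basis[OF g, of 0 \<one>] \<open>d \<noteq> 0\<close> by simp
      then show ?thesis using g \<open>d \<noteq> 0\<close> by (simp add: if_distrib[of "\<lambda>z. z * _"] cong: if_cong)
    qed
    have "(\<Sum>x\<in>carrier G. e 0 x) = (\<Sum>x\<in>carrier G. e 0 \<one>)"
      by (rule sum.cong[OF refl const])
    then have "e 0 \<one> = 0"
      using zero[of 0] \<open>d \<noteq> 0\<close> fin by (auto simp: zero_sum_def)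
    then have "e 0 x = 0" if "x \<in> carrier G" for x using const[OF that] by simp
    then have "ip (carrier G) (e 0) (e 0) = 0" by (simp add: ip_def)
    then show False using on \<open>d \<noteq> 0\<close> by (simp add: orthonormal_def)
  qed
  with representation_translation_matrix[OF on basis]
  have "nontrivial_representation G d (translation_matrix d e)"
    by (simp add: nontrivial_representation_def)
  then show ?thesis unfolding min_nontrivial_dim_def by (intro Least_le) blast
qed

section \<open>The spectral gap and the count of solutions\<close>

text \<open>The operator norm on sum-zero functions is smaller than the Hilbert-Schmidt norm by a factor of
  at least \<open>sqrt \<delta>\<close>, because the extremal value is attained on a whole representation of the group. The
  estimate holds for any kernel invariant under simultaneous right translation.\<close>

lemma quasirandom_energy_bound:
  assumes fin: "finite (carrier G)"
    and K: "\<And>x y g. x \<in> carrier G \<Longrightarrow> y \<in> carrier G \<Longrightarrow> g \<in> carrier G \<Longrightarrow>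
      K (x \<otimes> g) (y \<otimes> g) = K x y"
    and f: "f \<in> zero_sum (carrier G)"
  shows "real (min_nontrivial_dim G) * energy (carrier G) K f
    \<le> (\<Sum>x\<in>carrier G. ip (carrier G) (K x) (K x)) * ip (carrier G) f f"
proof (cases "ip (carrier G) f f = 0")
  case True
  then have "energy (carrier G) K f = 0"
    using ip_self_eq_0_iff[OF fin, of f] by (simp add: energy_def ip_def)
  with True show ?thesis by simp
next
  case False
  obtain f0 where f0: "f0 \<in> zero_sum (carrier G)" "ip (carrier G) f0 f0 = 1"
    and f0_max: "\<forall>g\<in>zero_sum (carrier G).
      energy (carrier G) K g \<le> energy (carrier G) K f0 * ip (carrier G) g g"
    by (rule energy_maximum_exists[where K = K, OF fin f False])
  define lam where "lam = energy (carrier G) K f0"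
  note max = f0_max[folded lam_def, rule_format]
  define E where
    "E = {f \<in> zero_sum (carrier G). energy (carrier G) K f = lam * ip (carrier G) f f}"
  have "linear_space E" unfolding E_def by (rule linear_space_maximisers[OF max])
  then obtain d e where on: "orthonormal (carrier G) d e" and eE: "\<forall>i<d. e i \<in> E"
    and expansion: "\<forall>f\<in>E. \<forall>x\<in>carrier G.
      f x = (\<Sum>i<d. ip (carrier G) f (e i) * e i x)"
    by (rule orthonormal_basis_exists[OF fin])
  note expand = expansion[rule_format]
  have translate: "(\<lambda>x. h (x \<otimes> g)) \<in> E" if "h \<in> E" "g \<in> carrier G" for h g
    using that zero_sum_right_translate ip_right_translate[of g h h]
      energy_right_translate[of g K h] K by (simp add: E_def)
  have "d \<noteq> 0"
  proof
    assume "d = 0"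
    then have "\<forall>x\<in>carrier G. f0 x = 0" using expand[of f0] f0 by (simp add: E_def lam_def)
    then show False using f0(2) by (simp add: ip_def)
  qed
  have "min_nontrivial_dim G \<le> d"
  proof (rule min_nontrivial_dim_le[OF fin on _ \<open>d \<noteq> 0\<close>])
    show "e i \<in> zero_sum (carrier G)" if "i < d" for i using eE that by (simp add: E_def)
    show "e j (x \<otimes> h) = (\<Sum>k<d. ip (carrier G) (e k) (\<lambda>y. e j (y \<otimes> h)) * e k x)"
      if "h \<in> carrier G" "j < d" "x \<in> carrier G" for h j x
      using expand[OF translate[of "e j" h], of x] eE that by (simp add: ip_commute)
  qed
  moreover have "0 \<le> lam" by (simp add: lam_def energy_def sum_nonneg)
  ultimately have "real (min_nontrivial_dim G) * lam \<le> real d * lam"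
    by (intro mult_right_mono) simp_all
  also have "\<dots> \<le> (\<Sum>x\<in>carrier G. ip (carrier G) (K x) (K x))"
    by (rule orthonormal_maximisers_le[OF on])
      (use eE on in \<open>simp add: E_def orthonormal_def\<close>)
  finally have gap: "real (min_nontrivial_dim G) * lam
    \<le> (\<Sum>x\<in>carrier G. ip (carrier G) (K x) (K x))" .
  have "real (min_nontrivial_dim G) * energy (carrier G) K f
      \<le> real (min_nontrivial_dim G) * (lam * ip (carrier G) f f)"
    by (intro mult_left_mono max f) simp
  also have "\<dots> = real (min_nontrivial_dim G) * lam * ip (carrier G) f f" by simp
  also have "\<dots> \<le> (\<Sum>x\<in>carrier G. ip (carrier G) (K x) (K x)) * ip (carrier G) f f"
    by (rule mult_right_mono[OF gap ip_self_nonneg])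
  finally show ?thesis .
qed

definition quotient_kernel :: "'a set \<Rightarrow> 'a \<Rightarrow> 'a \<Rightarrow> real" where
  "quotient_kernel A x y = (if x \<otimes> inv y \<in> A then 1 else 0)"

lemma quotient_kernel_translate:
  assumes "x \<in> carrier G" "y \<in> carrier G" "g \<in> carrier G"
  shows "quotient_kernel A (x \<otimes> g) (y \<otimes> g) = quotient_kernel A x y"
proof -
  have "x \<otimes> g \<otimes> inv (y \<otimes> g) = x \<otimes> inv y"
    using assms by (simp add: inv_mult_group m_assoc) (simp add: m_assoc[symmetric])
  then show ?thesis by (simp add: quotient_kernel_def)
qed

lemma quotient_kernel_row_sum:
  assumes "finite (carrier G)" "A \<subseteq> carrier G" "x \<in> carrier G"
  shows "(\<Sum>y\<in>carrier G. quotient_kernel A x y) = real (card A)"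
proof -
  have "(\<Sum>y\<in>carrier G. quotient_kernel A x y) = (\<Sum>a\<in>carrier G. if a \<in> A then 1 else 0)"
  proof (rule sum.reindex_bij_witness[where i = "\<lambda>a. inv a \<otimes> x" and j = "\<lambda>y. x \<otimes> inv y"])
    fix y assume "y \<in> carrier G"
    then show "inv (x \<otimes> inv y) \<otimes> x = y"
      using assms(3) by (simp add: inv_mult_group m_assoc)
  next
    fix a assume "a \<in> carrier G"
    then show "x \<otimes> inv (inv a \<otimes> x) = a"
      using assms(3) by (simp add: inv_mult_group) (simp add: m_assoc[symmetric])
  qed (use assms(3) in \<open>auto simp: quotient_kernel_def\<close>)
  also have "\<dots> = real (card A)"
    using assms(1,2) by (simp add: Int_absorb1 flip: sum.inter_restrict)
  finally show ?thesis .
qed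

text \<open>A solution is determined by \<open>c\<close> and \<open>b\<close>, and the pair \<open>(c, b)\<close> extends to one iff
  \<open>c \<otimes> inv b\<close> lies in \<open>A\<close>.\<close>

lemma card_solutions_eq:
  assumes fin: "finite (carrier G)"
    and "A \<subseteq> carrier G" "B \<subseteq> carrier G" "C \<subseteq> carrier G"
  shows "real (card {(a, b, c). a \<in> A \<and> b \<in> B \<and> c \<in> C \<and> a \<otimes> b = c})
    = (\<Sum>x\<in>C. \<Sum>y\<in>B. quotient_kernel A x y)"
proof -
  have fins: "finite B" "finite C" using assms finite_subset by blast+
  have "bij_betw (\<lambda>(a, b, c). (c, b)) {(a, b, c). a \<in> A \<and> b \<in> B \<and> c \<in> C \<and> a \<otimes> b = c}
      {(x, y). x \<in> C \<and> y \<in> B \<and> x \<otimes> inv y \<in> A}"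
  proof (rule bij_betw_byWitness[where f' = "\<lambda>(x, y). (x \<otimes> inv y, y, x)"])
  qed (use assms in \<open>force simp: m_assoc subset_iff\<close>)+
  then have "card {(a, b, c). a \<in> A \<and> b \<in> B \<and> c \<in> C \<and> a \<otimes> b = c}
      = card {(x, y). x \<in> C \<and> y \<in> B \<and> x \<otimes> inv y \<in> A}"
    by (rule bij_betw_same_card)
  also have "\<dots> = card {z \<in> C \<times> B. fst z \<otimes> inv (snd z) \<in> A}"
    by (rule arg_cong[where f = card]) auto
  also have "real \<dots> = (\<Sum>z\<in>C \<times> B. quotient_kernel A (fst z) (snd z))"
    using fins by (simp add: quotient_kernel_def flip: sum.inter_filter)
  finally show ?thesis by (simp add: sum.cartesian_product case_prod_beta)
qed

end

theorem theorem7: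
  fixes G (structure) and n \<delta> :: nat and A B C :: "'a set" and r s t p :: real
  assumes "group G" and "finite (carrier G)"
    and "n = order G" and "n > 1"
    and "\<delta> = min_nontrivial_dim G"
    and "A \<subseteq> carrier G" and "B \<subseteq> carrier G" and "C \<subseteq> carrier G"
    and "real (card A) = r * real n"
    and "real (card B) = s * real n"
    and "real (card C) = t * real n"
    and "real (card {(a, b, c). a \<in> A \<and> b \<in> B \<and> c \<in> C \<and> a \<otimes> b = c})
           = p * r * s * t * (real n)\<^sup>2"
  shows "r * s * t * (1 - p)\<^sup>2 * real \<delta> \<le> 1"
proof -
  interpret group G by fact
  let ?X = "carrier G"
  let ?K = "quotient_kernel A"
  note fin = assms(2)
  note cardA = assms(9) and cardB = assms(10) and cardC = assms(11)
  have n: "real n > 0" "real n = real (card ?X)"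
    using assms(3,4) by (simp_all add: order_def)
  have nonneg: "r \<ge> 0" "s \<ge> 0" "t \<ge> 0"
    using cardA cardB cardC n(1) by (metis of_nat_0_le_iff zero_le_mult_iff not_less)+
  \<comment> \<open>The indicator of B minus its mean s.\<close>
  define f where "f = (\<lambda>y. (if y \<in> B then 1 else 0) - s)"
  have sum_B: "(\<Sum>y\<in>?X. if y \<in> B then h y else 0) = sum h B" for h :: "'a \<Rightarrow> real"
    using fin assms(7) by (simp add: Int_absorb1 flip: sum.inter_restrict)
  have f_zero: "f \<in> zero_sum ?X"
    using sum_B[of "\<lambda>y. 1"] cardB n(2) by (simp add: zero_sum_def f_def sum_subtractf)
  have "ip ?X f f = (\<Sum>y\<in>?X. (if y \<in> B then 1 - 2 * s else 0) + s\<^sup>2)"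
    unfolding ip_def f_def by (rule sum.cong) (auto simp: power2_eq_square algebra_simps)
  also have "\<dots> = s * real n * (1 - 2 * s) + real n * s\<^sup>2"
    using sum_B[of "\<lambda>y. 1 - 2 * s"] cardB n(2) by (simp add: sum.distrib)
  also have "\<dots> = s * real n - real n * s\<^sup>2"
    by (simp add: power2_eq_square algebra_simps)
  also have "\<dots> \<le> s * real n" by simp
  finally have f_norm: "ip ?X f f \<le> s * real n" .
  have K_norm: "(\<Sum>x\<in>?X. ip ?X (?K x) (?K x)) = r * (real n)\<^sup>2"
  proof -
    have "ip ?X (?K x) (?K x) = r * real n" if "x \<in> ?X" for x
    proof -
      have "ip ?X (?K x) (?K x) = (\<Sum>y\<in>?X. ?K x y)"
        unfolding ip_def by (rule sum.cong) (auto simp: quotient_kernel_def)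
      then show ?thesis using quotient_kernel_row_sum[OF fin assms(6) that] cardA by simp
    qed
    then show ?thesis using n(2) by (simp add: power2_eq_square)
  qed
  have "real \<delta> * energy ?X ?K f \<le> r * (real n)\<^sup>2 * ip ?X f f"
    using quasirandom_energy_bound[where K = ?K, OF fin quotient_kernel_translate f_zero]
    by (simp add: K_norm assms(5))
  also have "\<dots> \<le> r * (real n)\<^sup>2 * (s * real n)"
    using f_norm nonneg by (intro mult_left_mono) simp_all
  finally have energy: "real \<delta> * energy ?X ?K f \<le> r * s * real n ^ 3"
    by (simp add: power2_eq_square power3_eq_cube algebra_simps)
  \<comment> \<open>Subtracting the mean removes the same expected amount r s n at every x.\<close>
  have "ip ?X (?K x) f = (\<Sum>y\<in>B. ?K x y) - r * s * real n" if "x \<in> C" for x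
  proof -
    have x: "x \<in> ?X" using that assms(8) by blast
    have "ip ?X (?K x) f = (\<Sum>y\<in>?X. (if y \<in> B then ?K x y else 0) - s * ?K x y)"
      unfolding ip_def f_def by (rule sum.cong) (auto simp: algebra_simps)
    then show ?thesis
      using sum_B[of "?K x"] quotient_kernel_row_sum[OF fin assms(6) x] cardA
      by (simp add: sum_subtractf flip: sum_distrib_left)
  qed
  then have "(\<Sum>x\<in>C. ip ?X (?K x) f) = p * r * s * t * (real n)\<^sup>2 - t * real n * (r * s * real n)"
    using card_solutions_eq[OF fin assms(6,7,8)] assms(12) cardC by (simp add: sum_subtractf)
  also have "\<dots> = - (r * s * t * (1 - p) * (real n)\<^sup>2)"
    by (simp add: power2_eq_square algebra_simps)
  finally have deviation: "(\<Sum>x\<in>C. ip ?X (?K x) f)\<^sup>2 = (r * s * t)\<^sup>2 * (1 - p)\<^sup>2 * real n ^ 4"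
    by (simp add: power_mult_distrib flip: power_mult)
  \<comment> \<open>Cauchy-Schwarz against the indicator of C.\<close>
  have "(\<Sum>x\<in>C. 1 * ip ?X (?K x) f)\<^sup>2 \<le> (\<Sum>x\<in>C. 1\<^sup>2) * (\<Sum>x\<in>C. (ip ?X (?K x) f)\<^sup>2)"
    by (rule Cauchy_Schwarz_ineq_sum)
  also have "\<dots> \<le> t * real n * energy ?X ?K f"
    unfolding energy_def using cardC nonneg fin assms(8)
    by (auto intro!: mult_left_mono sum_mono2)
  finally have "(r * s * t)\<^sup>2 * (1 - p)\<^sup>2 * real n ^ 4 \<le> t * real n * energy ?X ?K f"
    using deviation by simp
  then have "real \<delta> * ((r * s * t)\<^sup>2 * (1 - p)\<^sup>2 * real n ^ 4)
      \<le> real \<delta> * (t * real n * energy ?X ?K f)"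
    by (rule mult_left_mono) simp
  also have "\<dots> = t * real n * (real \<delta> * energy ?X ?K f)" by simp
  also have "\<dots> \<le> t * real n * (r * s * real n ^ 3)"
    using energy nonneg by (intro mult_left_mono) simp_all
  finally have scaled: "(r * s * t * real n ^ 4) * (r * s * t * (1 - p)\<^sup>2 * real \<delta>)
      \<le> (r * s * t * real n ^ 4) * 1"
    by (simp add: power2_eq_square power3_eq_cube power4_eq_xxxx algebra_simps)
  \<comment> \<open>If one of the sets is empty, p is arbitrary, but then the left-hand side of the claim is 0.\<close>
  show ?thesis
  proof (cases "r * s * t = 0")
    case True
    then show ?thesis by (metis mult_zero_left zero_le_one)
  next
    case False
    then have "r * s * t > 0"
      using nonneg mult_nonneg_nonneg[OF mult_nonneg_nonneg, of r s t] by linarith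
    then have "r * s * t * real n ^ 4 > 0"
      by (rule mult_pos_pos[OF _ zero_less_power[OF n(1)]])
    from mult_left_le_imp_le[OF scaled this] show ?thesis .
  qed
qed

end
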